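(* For every integer $m\ge 3$, $$\gamma_{\mathrm{sdR}}(P_{m,1})=\begin{cases} m & \text{if } m\equiv 0\pmod 2,\\ m+1 & \text{if } m\equiv 3\pmod 4,\\ m+2 & \text{if } m\equiv 1\pmod 4.\end{cases}$$
   Context: For $m\ge3$, $P_{m,1}$ (the $m$-prism) is the graph with vertex set $\{u_i,v_i:i\in\mathbb{Z}_m\}$ and edge set $\{u_iu_{i+1}, v_iv_{i+1}, u_iv_i: i\in\mathbb{Z}_m\}$. $N(u)$ is the open neighborhood, $N[u]=N(u)\cup\{u\}$; for $f:V\to\{-1,1,2,3\}$, $V_i=f^{-1}(i)$, $f(S)=\sum_{s\in S}f(s)$. A signed double Roman domination function (SDRDF) is $f:V\to\{-1,1,2,3\}$ with: (1) every $u\in V_{-1}$ has a neighbor in $V_3$ or at least two distinct neighbors in $V_2$; (2) every $u\in V_1$ has a neighbor in $V_2\cup V_3$; (3) $f(N[u])\ge1$ for all $u$. $\gamma_{\mathrm{sdR}}(G)$ is the minimum of $f(V)$ over all SDRDFs on $G$. *)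

theory Defs
  imports Main
begin

text \<open>
  A graph is a pair of a vertex set and a set of edges, an edge being an unordered pair
  \<open>{u, v}\<close> of distinct vertices.
\<close>

type_synonym 'a ugraph = "'a set \<times> 'a set set"

abbreviation verts :: "'a ugraph \<Rightarrow> 'a set" where
  "verts G \<equiv> fst G"

abbreviation edges :: "'a ugraph \<Rightarrow> 'a set set" where
  "edges G \<equiv> snd G"

definition simple_graph :: "'a ugraph \<Rightarrow> bool" where
  "simple_graph G \<longleftrightarrow> finite (verts G) \<and>
     (\<forall>e \<in> edges G. \<exists>u \<in> verts G. \<exists>v \<in> verts G. u \<noteq> v \<and> e = {u, v})"

definition nbhd :: "'a ugraph \<Rightarrow> 'a \<Rightarrow> 'a set" where
  "nbhd G u = {v \<in> verts G. {u, v} \<in> edges G}"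

definition closed_nbhd :: "'a ugraph \<Rightarrow> 'a \<Rightarrow> 'a set" where
  "closed_nbhd G u = insert u (nbhd G u)"

text \<open>
  Labellings are total functions on the vertex type; only their values on \<open>verts G\<close> matter.
\<close>

definition sdrdf :: "'a ugraph \<Rightarrow> ('a \<Rightarrow> int) \<Rightarrow> bool" where
  "sdrdf G f \<longleftrightarrow>
     (\<forall>u \<in> verts G. f u \<in> {-1, 1, 2, 3}) \<and>
     (\<forall>u \<in> verts G. f u = -1 \<longrightarrow>
        (\<exists>w \<in> nbhd G u. f w = 3) \<or>
        (\<exists>w \<in> nbhd G u. \<exists>w' \<in> nbhd G u. w \<noteq> w' \<and> f w = 2 \<and> f w' = 2)) \<and>
     (\<forall>u \<in> verts G. f u = 1 \<longrightarrow> (\<exists>w \<in> nbhd G u. f w = 2 \<or> f w = 3)) \<and>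
     (\<forall>u \<in> verts G. (\<Sum>w \<in> closed_nbhd G u. f w) \<ge> 1)"

definition weight :: "'a ugraph \<Rightarrow> ('a \<Rightarrow> int) \<Rightarrow> int" where
  "weight G f = (\<Sum>v \<in> verts G. f v)"

definition gamma_sdR :: "'a ugraph \<Rightarrow> int" where
  "gamma_sdR G = Min {weight G f | f. sdrdf G f}"

text \<open>
  For a finite graph the set of weights is finite and nonempty, so that \<^const>\<open>Min\<close> is the
  actual minimum.
\<close>

lemma finite_weights:
  assumes "finite (verts G)"
  shows "finite {weight G f | f. sdrdf G f}"
proof (rule finite_subset)
  show "{weight G f | f. sdrdf G f} \<subseteq> {- int (card (verts G)) .. 3 * int (card (verts G))}"
  proof clarify
    fix f assume f: "sdrdf G f"
    have b: "-1 \<le> f v \<and> f v \<le> 3" if "v \<in> verts G" for v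
      using f that unfolding sdrdf_def by fastforce
    have "(\<Sum>v \<in> verts G. -1) \<le> weight G f" "weight G f \<le> (\<Sum>v \<in> verts G. 3)"
      unfolding weight_def by (rule sum_mono, use b in blast)+
    then show "weight G f \<in> {- int (card (verts G)) .. 3 * int (card (verts G))}"
      by simp
  qed
qed simp

lemma sdrdf_const_2:
  assumes "finite (verts G)"
  shows "sdrdf G (\<lambda>_. 2)"
proof -
  have "finite (closed_nbhd G u)" for u
    using assms unfolding closed_nbhd_def nbhd_def by simp
  moreover have "closed_nbhd G u \<noteq> {}" for u
    unfolding closed_nbhd_def by simp
  ultimately have "card (closed_nbhd G u) > 0" for u
    by (simp add: card_gt_0_iff)
  then have "0 < 2 * int (card (closed_nbhd G u))" for u
    by simp
  then have "1 \<le> 2 * int (card (closed_nbhd G u))" for u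
    by (simp only: int_one_le_iff_zero_less)
  then show ?thesis
    unfolding sdrdf_def by (simp add: mult.commute)
qed

lemma weights_nonempty:
  assumes "finite (verts G)"
  shows "{weight G f | f. sdrdf G f} \<noteq> {}"
  using sdrdf_const_2[OF assms] by blast

text \<open>The index set \<open>\<int>\<^sub>m\<close> is represented by \<open>{0..<m}\<close> with addition modulo \<open>m\<close>.\<close>

datatype prism_vertex = U nat | V nat

definition prism :: "nat \<Rightarrow> prism_vertex ugraph" where
  "prism m =
     (U ` {0..<m} \<union> V ` {0..<m},
      {{U i, U ((i + 1) mod m)} | i. i < m} \<union>
      {{V i, V ((i + 1) mod m)} | i. i < m} \<union>
      {{U i, V i} | i. i < m})"

lemma simple_graph_prism:
  assumes "m \<ge> 3"
  shows "simple_graph (prism m)"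
proof -
  have succ: "i \<noteq> (i + 1) mod m" "(i + 1) mod m < m" if "i < m" for i
    using that assms by (cases "i + 1 = m"; simp)+
  have "\<exists>u \<in> verts (prism m). \<exists>v \<in> verts (prism m). u \<noteq> v \<and> e = {u, v}"
    if "e \<in> edges (prism m)" for e
  proof -
    from that consider
      (uu) i where "i < m" "e = {U i, U ((i + 1) mod m)}"
      | (vv) i where "i < m" "e = {V i, V ((i + 1) mod m)}"
      | (uv) i where "i < m" "e = {U i, V i}"
      unfolding prism_def snd_conv by blast
    then show ?thesis
    proof cases
      case uu
      show ?thesis
        by (rule bexI[of _ "U i"], rule bexI[of _ "U ((i + 1) mod m)"])
          (use uu succ[of i] in \<open>simp_all add: prism_def\<close>)
    next
      case vv
      show ?thesis
        by (rule bexI[of _ "V i"], rule bexI[of _ "V ((i + 1) mod m)"])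
          (use vv succ[of i] in \<open>simp_all add: prism_def\<close>)
    next
      case uv
      show ?thesis
        by (rule bexI[of _ "U i"], rule bexI[of _ "V i"])
          (use uv in \<open>simp_all add: prism_def\<close>)
    qed
  qed
  then show ?thesis
    unfolding simple_graph_def by (simp add: prism_def)
qed

end

(*
  View a labelling as a cyclic sequence of columns (f(u_i), f(v_i)) and let g be the number of
  columns without a -1 minus the number of columns (-1, -1).  Both neighbours of a column
  (-1, -1) are free of -1, so g counts the columns without a -1 that are not followed by (-1, -1).

  Discharging shows that the weight is at least m + g: columns without a -1 pass their surplus
  over 2 to both neighbours, and two adjacent columns whose single -1s lie in different rows
  balance their weights; afterwards every column has a nonnegative remainder.

  If g = 0, then either columns (-1, -1) alternate with columns without a -1, or every column
  has exactly one -1 and its row changes every second step; in both cases m is even.  Hence the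
  weight is at least m + 1 for odd m.  If it equals m + 1, then g = 1 and all remainders vanish.
  Such sequences are so rigid that each pair of consecutive columns has a phase modulo 4 that
  increases by one per step, and by one more on entering a column without a -1 from a column
  other than (-1, -1); going round the cycle gives m + g = 0 modulo 4, that is m = 3 modulo 4.
*)

theory Submission
  imports Defs
begin

section \<open>Local conditions, charges and phases of columns\<close>

type_synonym column = "int \<times> int"

definition columns :: "column list" where
  "columns = List.product [-1, 1, 2, 3] [-1, 1, 2, 3]"

text \<open>The conditions at a vertex of degree three: \<open>x\<close> is its label,
  \<open>a\<close>, \<open>b\<close>, \<open>c\<close> are those of its neighbours.\<close>

definition vertex_ok :: "int \<Rightarrow> int \<Rightarrow> int \<Rightarrow> int \<Rightarrow> bool" where
  "vertex_ok x a b c \<longleftrightarrow>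
     (x = -1 \<longrightarrow> a = 3 \<or> b = 3 \<or> c = 3 \<or> a = 2 \<and> b = 2 \<or> a = 2 \<and> c = 2 \<or> b = 2 \<and> c = 2) \<and>
     (x = 1 \<longrightarrow> a = 2 \<or> a = 3 \<or> b = 2 \<or> b = 3 \<or> c = 2 \<or> c = 3) \<and>
     1 \<le> x + a + b + c"

definition column_ok :: "column \<Rightarrow> column \<Rightarrow> column \<Rightarrow> bool" where
  "column_ok p q s \<longleftrightarrow>
     vertex_ok (fst q) (fst p) (fst s) (snd q) \<and> vertex_ok (snd q) (snd p) (snd s) (fst q)"

definition column_weight :: "column \<Rightarrow> int" where
  "column_weight q = fst q + snd q"

definition no_neg :: "column \<Rightarrow> bool" where
  "no_neg q \<longleftrightarrow> fst q \<noteq> -1 \<and> snd q \<noteq> -1"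

definition both_neg :: "column \<Rightarrow> bool" where
  "both_neg q \<longleftrightarrow> fst q = -1 \<and> snd q = -1"

definition opposite :: "column \<Rightarrow> column \<Rightarrow> bool" where
  "opposite p q \<longleftrightarrow>
     fst p = -1 \<and> snd p \<noteq> -1 \<and> fst q \<noteq> -1 \<and> snd q = -1 \<or>
     fst p \<noteq> -1 \<and> snd p = -1 \<and> fst q = -1 \<and> snd q \<noteq> -1"

definition surplus :: "column \<Rightarrow> int" where
  "surplus q = (if no_neg q then column_weight q - 2 else 0)"

text \<open>
  In units of \<open>1/4\<close>. Opposite columns whose weights differ by 2 have to balance completely; the
  smaller transfer for difference 1, effected by the factor \<open>\<bar>d\<bar>\<close>, leaves fewer triples with zero
  slack than the transfer \<open>2 * d\<close> would.
\<close>

definition flow :: "column \<Rightarrow> column \<Rightarrow> int" where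
  "flow p q = 2 * (surplus p - surplus q) +
     (if opposite p q
      then (column_weight p - column_weight q) * \<bar>column_weight p - column_weight q\<bar> else 0)"

definition excess :: "column \<Rightarrow> int" where
  "excess q = column_weight q - 1 - of_bool (no_neg q) + of_bool (both_neg q)"

text \<open>Four times the charge left at \<open>q\<close>, with \<open>flow p q\<close> received
  and \<open>flow q s\<close> passed on.\<close>

definition slack :: "column \<Rightarrow> column \<Rightarrow> column \<Rightarrow> int" where
  "slack p q s = 4 * excess q + flow p q - flow q s"

definition single_neg :: "column \<Rightarrow> bool" where
  "single_neg q \<longleftrightarrow> \<not> no_neg q \<and> \<not> both_neg q"

text \<open>
  Sequences alternating between \<open>(-1, -1)\<close> and \<open>(2, _)\<close> admit no phase modulo 4 because of the
  2-cycle through \<open>(2, 2)\<close>; in a tight sequence they never leave this pattern.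
\<close>

definition has_two :: "column \<Rightarrow> column \<Rightarrow> bool" where
  "has_two p q \<longleftrightarrow> fst p = 2 \<and> no_neg p \<or> fst q = 2 \<and> no_neg q"

text \<open>When the single -1 runs through rows 1, 1, 2, 2 periodically, the four kinds of pairs
  get 0, 1, 2, 3. A column without -1 is read as having its -1 in the same row as its neighbour,
  unless its entry there is 3. Beside \<open>(-1, -1)\<close> the phase follows first-row entries
  alternating between 1 and 3.\<close>

definition phase :: "column \<Rightarrow> column \<Rightarrow> int" where
  "phase p q =
    (if both_neg q then fst p
     else if both_neg p then fst q - 1
     else if no_neg p then (if fst q = -1 then (if fst p = 3 then 3 else 0)
                            else (if snd p = 3 then 1 else 2))
     else if no_neg q then (if fst p = -1 then (if fst q = 3 then 1 else 0)
                            else (if snd q = 3 then 3 else 2))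
     else if fst p = -1 then (if fst q = -1 then 0 else 1)
     else (if fst q = -1 then 3 else 2))"

definition phase_step :: "column \<Rightarrow> column \<Rightarrow> column \<Rightarrow> bool" where
  "phase_step p q s \<longleftrightarrow>
    (if has_two p q \<or> has_two q s
     then has_two p q \<and> has_two q s \<and> (no_neg q \<longrightarrow> both_neg s)
     else (phase q s - phase p q) mod 4 = (1 + of_bool (no_neg q \<and> \<not> both_neg p)) mod 4)"

definition tight :: "column \<Rightarrow> column \<Rightarrow> column \<Rightarrow> bool" where
  "tight p q s \<longleftrightarrow> column_ok p q s \<and> slack p q s = 0"

text \<open>Evaluation covers all triples. Two of the facts by hand: the labels left and right of a
  vertex of \<open>(-1, -1)\<close> sum to at least 3, which excludes -1; a column with a single -1
  has weight at most 2, so no vertex of it has -1 on both sides.\<close>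

lemma column_ok_facts:
  "\<forall>p \<in> set columns. \<forall>q \<in> set columns. \<forall>s \<in> set columns. column_ok p q s \<longrightarrow>
     0 \<le> slack p q s \<and> (both_neg q \<longrightarrow> no_neg p \<and> no_neg s) \<and>
     (single_neg p \<and> single_neg q \<and> single_neg s \<longrightarrow> (fst s = -1 \<longleftrightarrow> fst p \<noteq> -1))"
  by code_simp

text \<open>
  The outer columns are needed: some tight triples do not extend to tight sequences.
\<close>

lemma tight_facts:
  "\<forall>p \<in> set columns. \<forall>q \<in> set columns. \<forall>s \<in> set columns. tight p q s \<longrightarrow>
     (\<forall>o' \<in> set columns. tight o' p q \<longrightarrow> (\<forall>t \<in> set columns. tight q s t \<longrightarrow>
       phase_step p q s))"
  by code_simp

section \<open>Cyclic sequences of columns and the lower bounds\<close>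

locale column_cycle =
  fixes m :: nat and c :: "nat \<Rightarrow> column"
  assumes pos: "0 < m"
    and periodic: "c (i + m) = c i"
    and columns: "c i \<in> set columns"
    and ok: "column_ok (c i) (c (Suc i)) (c (Suc (Suc i)))"
begin

definition gaps :: int where
  "gaps = (\<Sum>i<m. of_bool (no_neg (c i)) - of_bool (both_neg (c i)))"

lemma periodic_mult: "c (i + n * m) = c i"
proof (induction n)
  case (Suc n)
  then show ?case using periodic[of "i + n * m"] by (simp add: algebra_simps)
qed simp

text \<open>Going \<open>n\<close> times round the cycle carries any index to at least
  \<open>n\<close>.\<close>

lemma eventually_all:
  assumes "\<And>i. n \<le> i \<Longrightarrow> P (c i) (c (Suc i))"
  shows "P (c i) (c (Suc i))"
proof -
  have "n \<le> i + n * m"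
    using pos by (simp add: trans_le_add2)
  from assms[OF this] show ?thesis
    using periodic_mult[of i n] periodic_mult[of "Suc i" n] by simp
qed

lemma below_period_all:
  assumes "\<And>i. i < m \<Longrightarrow> P (c i) (c (Suc i)) (c (Suc (Suc i)))"
  shows "P (c i) (c (Suc i)) (c (Suc (Suc i)))"
proof -
  have eq: "i = i mod m + (i div m) * m" by simp
  have "c (k + i) = c (k + i mod m)" for k
    using periodic_mult[of "k + i mod m" "i div m"] eq by (metis add.assoc)
  from this[of 0] this[of 1] this[of 2] show ?thesis
    using assms[of "i mod m"] pos by simp
qed

lemma sum_shift:
  fixes h :: "nat \<Rightarrow> int"
  assumes "h m = h 0"
  shows "(\<Sum>i<m. h (Suc i)) = (\<Sum>i<m. h i)"
  using assms sum.lessThan_Suc_shift[of h m] by simp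

lemma sum_shift_column:
  fixes h :: "column \<Rightarrow> int"
  shows "(\<Sum>i<m. h (c (Suc i))) = (\<Sum>i<m. h (c i))"
  by (rule sum_shift) (use periodic[of 0] in simp)

lemma sum_shift_pair:
  fixes h :: "column \<Rightarrow> column \<Rightarrow> int"
  shows "(\<Sum>i<m. h (c (Suc i)) (c (Suc (Suc i)))) = (\<Sum>i<m. h (c i) (c (Suc i)))"
  by (rule sum_shift) (use periodic[of 0] periodic[of 1] in simp)

lemma both_neg_next:
  assumes "both_neg (c i)"
  shows "no_neg (c (Suc i))"
proof -
  \<comment> \<open>\<open>column_ok_facts\<close> concerns the middle of a triple; one round later
    the column has a predecessor even for \<open>i = 0\<close>.\<close>
  from pos obtain k where k: "m = Suc k" by (cases m) auto
  have "both_neg (c (Suc (i + k)))"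
    using assms periodic[of i] k by simp
  then have "no_neg (c (Suc (Suc (i + k))))"
    using column_ok_facts columns ok by blast
  then show ?thesis
    using periodic[of "Suc i"] k by simp
qed

lemma both_neg_prev:
  assumes "both_neg (c (Suc i))"
  shows "no_neg (c i)"
  using assms column_ok_facts columns ok by blast

text \<open>Each \<open>(-1, -1)\<close> cancels against the preceding column, which is free of
  -1.\<close>

lemma gaps_out: "gaps = (\<Sum>i<m. of_bool (no_neg (c i) \<and> \<not> both_neg (c (Suc i))))"
proof -
  have "gaps = (\<Sum>i<m. of_bool (no_neg (c i))) - (\<Sum>i<m. of_bool (both_neg (c (Suc i))))"
    by (simp add: gaps_def sum_subtractf sum_shift_column[of "\<lambda>q. of_bool (both_neg q)"])
  also have "\<dots> = (\<Sum>i<m. of_bool (no_neg (c i)) - of_bool (both_neg (c (Suc i))))"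
    by (rule sum_subtractf[symmetric])
  also have "\<dots> = (\<Sum>i<m. of_bool (no_neg (c i) \<and> \<not> both_neg (c (Suc i))))"
    using both_neg_prev by (intro sum.cong) auto
  finally show ?thesis .
qed

text \<open>Cancelling against the following column instead gives the extra increment in
  \<open>phase_step\<close>.\<close>

lemma gaps_in: "gaps = (\<Sum>i<m. of_bool (no_neg (c (Suc i)) \<and> \<not> both_neg (c i)))"
proof -
  have "gaps = (\<Sum>i<m. of_bool (no_neg (c (Suc i)))) - (\<Sum>i<m. of_bool (both_neg (c i)))"
    by (simp add: gaps_def sum_subtractf sum_shift_column[of "\<lambda>q. of_bool (no_neg q)"])
  also have "\<dots> = (\<Sum>i<m. of_bool (no_neg (c (Suc i))) - of_bool (both_neg (c i)))"
    by (rule sum_subtractf[symmetric])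
  also have "\<dots> = (\<Sum>i<m. of_bool (no_neg (c (Suc i)) \<and> \<not> both_neg (c i)))"
    using both_neg_next by (intro sum.cong) auto
  finally show ?thesis .
qed

lemma gaps_nonneg: "0 \<le> gaps"
  unfolding gaps_out by (intro sum_nonneg) simp

text \<open>What a column passes on is what its successor receives, so all flows cancel round the
  cycle.\<close>

lemma sum_slack:
  "(\<Sum>i<m. slack (c i) (c (Suc i)) (c (Suc (Suc i)))) =
     4 * ((\<Sum>i<m. column_weight (c i)) - int m - gaps)"
proof -
  have "(\<Sum>i<m. slack (c i) (c (Suc i)) (c (Suc (Suc i)))) = 4 * (\<Sum>i<m. excess (c (Suc i)))"
    by (simp add: slack_def sum.distrib sum_subtractf sum_distrib_left sum_shift_pair[of flow])
  also have "(\<Sum>i<m. excess (c (Suc i))) = (\<Sum>i<m. excess (c i))"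
    by (rule sum_shift_column)
  also have "\<dots> = (\<Sum>i<m. column_weight (c i)) - int m - gaps"
    by (simp add: excess_def gaps_def sum.distrib sum_subtractf)
  finally show ?thesis .
qed

lemma slack_nonneg: "0 \<le> slack (c i) (c (Suc i)) (c (Suc (Suc i)))"
  using column_ok_facts columns ok by blast

lemma weight_ge: "int m + gaps \<le> (\<Sum>i<m. column_weight (c i))"
proof -
  have "0 \<le> (\<Sum>i<m. slack (c i) (c (Suc i)) (c (Suc (Suc i))))"
    by (intro sum_nonneg slack_nonneg)
  then show ?thesis
    unfolding sum_slack by simp
qed

lemma even_if_no_gaps:
  assumes "gaps = 0"
  shows "even m"
proof (rule ccontr)
  assume "odd m"
  have out: "no_neg (c i) \<longleftrightarrow> both_neg (c (Suc i))" for i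
  proof (rule below_period_all[where P = "\<lambda>p q s. no_neg p \<longleftrightarrow> both_neg q"])
    fix i assume "i < m"
    then have "\<not> (no_neg (c i) \<and> \<not> both_neg (c (Suc i)))"
      using assms sum_nonneg_eq_0_iff[of "{..<m}" "\<lambda>i. of_bool (no_neg (c i) \<and> \<not> both_neg (c (Suc i))) :: int"]
      unfolding gaps_out by simp
    then show "no_neg (c i) \<longleftrightarrow> both_neg (c (Suc i))"
      using both_neg_prev by blast
  qed
  show False
  proof (cases "\<exists>i. no_neg (c i)")
    case True
    then obtain i where i: "no_neg (c i)" ..
    \<comment> \<open>Columns without -1 recur every second step, so after an odd number
      \<open>m\<close> of steps there would be \<open>(-1, -1)\<close> instead.\<close>
    have alternate: "no_neg (c (i + 2 * k))" for k
      by (induction k) (use i out both_neg_next in auto)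
    from \<open>odd m\<close> obtain k where "m = 2 * k + 1" by (elim oddE)
    then have "both_neg (c (i + m))"
      using alternate[of k] out by simp
    then show False
      using i periodic by (simp add: no_neg_def both_neg_def)
  next
    case False
    then have "single_neg (c i)" for i
      using both_neg_next unfolding single_neg_def by blast
    then have flip: "fst (c (Suc (Suc i))) = -1 \<longleftrightarrow> fst (c i) \<noteq> -1" for i
      using column_ok_facts columns ok by blast
    \<comment> \<open>Two rounds make \<open>m\<close> flips; an odd number of flips cannot restore
      the initial row.\<close>
    have "fst (c (2 * k)) = -1 \<longleftrightarrow> (fst (c 0) = -1 \<longleftrightarrow> even k)" for k
      by (induction k) (use flip in auto)
    from this[of m] \<open>odd m\<close> show False
      using periodic_mult[of 0 2] by simp
  qed
qed

lemma mod_4_if_tight: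
  assumes "odd m" and weight: "(\<Sum>i<m. column_weight (c i)) = int m + 1"
  shows "m mod 4 = 3"
proof -
  have "gaps \<noteq> 0" using \<open>odd m\<close> even_if_no_gaps by blast
  then have gaps: "gaps = 1" using gaps_nonneg weight_ge weight by linarith
  have "slack (c i) (c (Suc i)) (c (Suc (Suc i))) = 0" for i
  proof (rule below_period_all[where P = "\<lambda>p q s. slack p q s = 0"])
    fix i assume "i < m"
    moreover have "(\<Sum>i<m. slack (c i) (c (Suc i)) (c (Suc (Suc i)))) = 0"
      unfolding sum_slack by (simp add: weight gaps)
    ultimately show "slack (c i) (c (Suc i)) (c (Suc (Suc i))) = 0"
      using sum_nonneg_eq_0_iff[of "{..<m}" "\<lambda>i. slack (c i) (c (Suc i)) (c (Suc (Suc i)))"]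
        slack_nonneg by simp
  qed
  then have tight: "tight (c i) (c (Suc i)) (c (Suc (Suc i)))" for i
    unfolding tight_def using ok by blast
  have steps: "phase_step (c i) (c (Suc i)) (c (Suc (Suc i)))" (is "?P i") for i
  proof -
    \<comment> \<open>One round later the triple has a predecessor, as \<open>tight_facts\<close>
      requires.\<close>
    from pos obtain k where k: "i + m = Suc k" by (cases "i + m") auto
    have "?P (Suc k)"
      using tight_facts columns tight by blast
    then have "?P (i + m)" by (simp only: k)
    then show ?thesis
      using periodic[of i] periodic[of "Suc i"] periodic[of "Suc (Suc i)"] by simp
  qed
  show ?thesis
  proof (cases "\<exists>j. has_two (c j) (c (Suc j))")
    case True
    then obtain j where j: "has_two (c j) (c (Suc j))" ..
    \<comment> \<open>Once begun, the pattern with 2s persists; by periodicity it fills the cycle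
      and forces \<open>gaps = 0\<close>, a contradiction.\<close>
    have two: "has_two (c i) (c (Suc i))" if "j \<le> i" for i
      using that
    proof (induction i rule: dec_induct)
      case base show ?case by (fact j)
    next
      case (step n)
      then show ?case using steps[of n]
        by (simp add: phase_step_def)
    qed
    have "no_neg (c i) \<longrightarrow> both_neg (c (Suc i))" for i
    proof (rule eventually_all[where n = "Suc j" and P = "\<lambda>p q. no_neg p \<longrightarrow> both_neg q"])
      fix i assume "Suc j \<le> i"
      then obtain k where "i = Suc k" "j \<le> k" by (cases i) auto
      then show "no_neg (c i) \<longrightarrow> both_neg (c (Suc i))"
        using steps[of k] two[of k] by (simp add: phase_step_def)
    qed
    then have "gaps = 0"
      unfolding gaps_out by (intro sum.neutral) simp
    then show ?thesis using gaps by simp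
  next
    case False
    then have no_two: "\<not> has_two (c i) (c (Suc i))" for i by blast
    have "4 dvd phase (c (Suc i)) (c (Suc (Suc i))) - phase (c i) (c (Suc i)) -
        (1 + of_bool (no_neg (c (Suc i)) \<and> \<not> both_neg (c i)))" for i
      using steps[of i] no_two[of i] no_two[of "Suc i"]
      by (simp only: phase_step_def mod_eq_dvd_iff if_False simp_thms)
    \<comment> \<open>The phases cancel round the cycle; the increments add up to
      \<open>m + gaps\<close> by \<open>gaps_in\<close>.\<close>
    then have "4 dvd (\<Sum>i<m. phase (c (Suc i)) (c (Suc (Suc i))) - phase (c i) (c (Suc i)) -
        (1 + of_bool (no_neg (c (Suc i)) \<and> \<not> both_neg (c i))))"
      by (intro dvd_sum) blast
    also have "\<dots> = - (int m + gaps)"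
      by (simp add: sum_subtractf sum.distrib sum_shift_pair[of phase] gaps_in)
    finally have "4 dvd - (int m + 1)" by (simp only: gaps)
    then show ?thesis by presburger
  qed
qed

end

section \<open>Translation between prism labellings and columns\<close>

definition prism_columns :: "nat \<Rightarrow> (prism_vertex \<Rightarrow> int) \<Rightarrow> nat \<Rightarrow> column" where
  "prism_columns m f i = (f (U (i mod m)), f (V (i mod m)))"

lemma Suc_mod_eq_iff:
  fixes m :: nat
  assumes "j < m"
  shows "Suc j mod m = Suc i mod m \<longleftrightarrow> j = i mod m"
  using assms by (auto simp: mod_Suc split: if_splits)

lemma prism_edge_iff:
  "{U a, U b} \<in> edges (prism m) \<longleftrightarrow> a < m \<and> b = Suc a mod m \<or> b < m \<and> a = Suc b mod m"
  "{V a, V b} \<in> edges (prism m) \<longleftrightarrow> a < m \<and> b = Suc a mod m \<or> b < m \<and> a = Suc b mod m"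
  "{U a, V b} \<in> edges (prism m) \<longleftrightarrow> a < m \<and> a = b"
  "{V b, U a} \<in> edges (prism m) \<longleftrightarrow> a < m \<and> a = b"
  unfolding prism_def by (auto simp: doubleton_eq_iff)

lemma verts_prism: "u \<in> verts (prism m) \<longleftrightarrow> (\<exists>i<m. u = U i \<or> u = V i)"
  unfolding prism_def by auto

text \<open>Centring at \<open>Suc i\<close> makes \<open>i mod m\<close> the predecessor without
  subtraction.\<close>

lemma nbhd_prism:
  assumes "3 \<le> m"
  shows "nbhd (prism m) (U (Suc i mod m)) =
      {U (i mod m), U (Suc (Suc i) mod m), V (Suc i mod m)}" (is "?U = _")
    and "nbhd (prism m) (V (Suc i mod m)) =
      {V (i mod m), V (Suc (Suc i) mod m), U (Suc i mod m)}" (is "?V = _")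
proof -
  have lt: "k mod m < m" for k using assms by simp
  have iff: "Suc i mod m < m \<and> b = Suc (Suc i mod m) mod m \<or> b < m \<and> Suc i mod m = Suc b mod m
      \<longleftrightarrow> b = Suc (Suc i) mod m \<or> b = i mod m" for b
    using lt Suc_mod_eq_iff[of b m i] by (auto simp: mod_Suc_eq)
  show "?U = {U (i mod m), U (Suc (Suc i) mod m), V (Suc i mod m)}"
  proof (rule set_eqI)
    fix w show "w \<in> ?U \<longleftrightarrow> w \<in> {U (i mod m), U (Suc (Suc i) mod m), V (Suc i mod m)}"
      unfolding nbhd_def verts_prism mem_Collect_eq
      by (cases w) (simp_all only: prism_edge_iff iff, use lt in auto)
  qed
  show "?V = {V (i mod m), V (Suc (Suc i) mod m), U (Suc i mod m)}"
  proof (rule set_eqI)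
    fix w show "w \<in> ?V \<longleftrightarrow> w \<in> {V (i mod m), V (Suc (Suc i) mod m), U (Suc i mod m)}"
      unfolding nbhd_def verts_prism mem_Collect_eq
      by (cases w) (simp_all only: prism_edge_iff iff, use lt in auto)
  qed
qed

definition sdrdf_at :: "'a ugraph \<Rightarrow> ('a \<Rightarrow> int) \<Rightarrow> 'a \<Rightarrow> bool" where
  "sdrdf_at G f u \<longleftrightarrow> f u \<in> {-1, 1, 2, 3} \<and>
     (f u = -1 \<longrightarrow> (\<exists>w \<in> nbhd G u. f w = 3) \<or>
        (\<exists>w \<in> nbhd G u. \<exists>w' \<in> nbhd G u. w \<noteq> w' \<and> f w = 2 \<and> f w' = 2)) \<and>
     (f u = 1 \<longrightarrow> (\<exists>w \<in> nbhd G u. f w = 2 \<or> f w = 3)) \<and>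
     (\<Sum>w \<in> closed_nbhd G u. f w) \<ge> 1"

lemma sdrdf_iff_at: "sdrdf G f \<longleftrightarrow> (\<forall>u \<in> verts G. sdrdf_at G f u)"
  unfolding sdrdf_def sdrdf_at_def by blast

text \<open>Distinctness turns pairs of distinct neighbours into pairs of positions and splits the
  closed neighbourhood sum into four terms.\<close>

lemma sdrdf_at_iff_vertex_ok:
  assumes "nbhd G u = {x, y, z}" and "distinct [u, x, y, z]"
  shows "sdrdf_at G f u \<longleftrightarrow> f u \<in> {-1, 1, 2, 3} \<and> vertex_ok (f u) (f x) (f y) (f z)"
proof -
  have "(\<Sum>w \<in> closed_nbhd G u. f w) = f u + f x + f y + f z"
    using assms by (simp add: closed_nbhd_def)
  then show ?thesis
    unfolding sdrdf_at_def vertex_ok_def using assms by auto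
qed

lemma sdrdf_prism_iff:
  assumes "3 \<le> m"
  shows "sdrdf (prism m) f \<longleftrightarrow> (\<forall>i. prism_columns m f i \<in> set columns \<and>
     column_ok (prism_columns m f i) (prism_columns m f (Suc i)) (prism_columns m f (Suc (Suc i))))"
    (is "_ \<longleftrightarrow> (\<forall>i. ?in i \<and> ?ok i)")
proof -
  have ne: "Suc i mod m \<noteq> i mod m" "Suc i mod m \<noteq> Suc (Suc i) mod m"
    "i mod m \<noteq> Suc (Suc i) mod m" for i
    using assms by (auto simp: mod_Suc)
  have at: "sdrdf_at (prism m) f (U (Suc i mod m)) \<and> sdrdf_at (prism m) f (V (Suc i mod m)) \<longleftrightarrow>
      ?in (Suc i) \<and> ?ok i" for i
  proof -
    have distinct: "distinct [U (Suc i mod m), U (i mod m), U (Suc (Suc i) mod m), V (Suc i mod m)]"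
      "distinct [V (Suc i mod m), V (i mod m), V (Suc (Suc i) mod m), U (Suc i mod m)]"
      using ne[of i] by auto
    show ?thesis
      unfolding sdrdf_at_iff_vertex_ok[OF nbhd_prism(1)[OF assms] distinct(1)]
        sdrdf_at_iff_vertex_ok[OF nbhd_prism(2)[OF assms] distinct(2)]
      by (auto simp: prism_columns_def column_ok_def columns_def)
  qed
  \<comment> \<open>Adding \<open>m\<close> first avoids truncated subtraction at
    \<open>i = 0\<close>.\<close>
  have pred: "\<exists>k. i mod m = Suc k mod m" for i
    by (rule exI[of _ "i + m - 1"]) (use assms in simp)
  have in_shift: "(\<forall>i. ?in i) \<longleftrightarrow> (\<forall>i. ?in (Suc i))"
    using pred unfolding prism_columns_def by metis
  have verts: "(\<forall>u \<in> verts (prism m). P u) \<longleftrightarrow> (\<forall>i. P (U (Suc i mod m)) \<and> P (V (Suc i mod m)))" for P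
  proof -
    have "Suc i mod m < m" for i using assms by simp
    then show ?thesis
      unfolding Ball_def verts_prism using pred by (metis mod_less)
  qed
  show ?thesis
    unfolding sdrdf_iff_at verts at using in_shift by blast
qed

lemma weight_prism: "weight (prism m) f = (\<Sum>i<m. column_weight (prism_columns m f i))"
proof -
  have "weight (prism m) f = (\<Sum>i<m. f (U i)) + (\<Sum>i<m. f (V i))"
    unfolding weight_def prism_def fst_conv atLeast0LessThan
    by (subst sum.union_disjoint) (auto simp: sum.reindex inj_on_def)
  then show ?thesis
    by (simp add: column_weight_def prism_columns_def sum.distrib)
qed

lemma column_cycle_prism:
  assumes "3 \<le> m" "sdrdf (prism m) f"
  shows "column_cycle m (prism_columns m f)"
  using assms by unfold_locales (auto simp: sdrdf_prism_iff prism_columns_def)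

lemma gamma_sdR_eqI:
  assumes "finite (verts G)" "sdrdf G f" "weight G f = n"
    and "\<And>f. sdrdf G f \<Longrightarrow> n \<le> weight G f"
  shows "gamma_sdR G = n"
  unfolding gamma_sdR_def using assms by (intro Min_eqI finite_weights) auto

section \<open>Labellings attaining the bounds\<close>

fun labelling :: "(nat \<Rightarrow> column) \<Rightarrow> prism_vertex \<Rightarrow> int" where
  "labelling d (U i) = fst (d i)"
| "labelling d (V i) = snd (d i)"

lemma prism_columns_labelling: "prism_columns m (labelling d) i = d (i mod m)"
  by (simp add: prism_columns_def)

text \<open>The alternating weights -2 and 4 average 1, even \<open>m\<close> closes the pattern,
  and each -1 lies between two 2s in its row.\<close>

lemma labelling_even:
  assumes "3 \<le> m" "even m"
  defines "d \<equiv> \<lambda>i. if even i then (-1, -1) else (2, 2)"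
  shows "sdrdf (prism m) (labelling d)" "weight (prism m) (labelling d) = int m"
proof -
  have d: "prism_columns m (labelling d) i = d i" for i
    using \<open>even m\<close> by (simp add: prism_columns_labelling d_def dvd_mod_iff)
  show "sdrdf (prism m) (labelling d)"
    unfolding sdrdf_prism_iff[OF assms(1)] d
    by (simp add: d_def columns_def column_ok_def vertex_ok_def)
  from \<open>even m\<close> obtain k where m: "m = 2 * k" by (elim evenE)
  have "(\<Sum>i<2 * k. column_weight (d i)) = 2 * int k"
    by (induction k) (simp_all add: d_def column_weight_def)
  then show "weight (prism m) (labelling d) = int m"
    unfolding weight_prism d by (simp add: m)
qed

text \<open>From column 1 on, every column has weight 1 and the -1 changes row every second step;
  column 0 closes the seam. For \<open>m mod 4 = 1\<close> its first-row neighbours are both -1, so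
  \<open>x = 1\<close> would leave the sum 0 at \<open>U 0\<close>.\<close>

definition odd_columns :: "int \<Rightarrow> nat \<Rightarrow> column" where
  "odd_columns x i = (if i = 0 then (x, 1) else if i mod 4 \<in> {0, 1} then (-1, 2) else (2, -1))"

lemma labelling_odd:
  assumes "3 \<le> m" "m mod 4 = 3 \<and> x = 1 \<or> m mod 4 = 1 \<and> x = 2"
  defines "f \<equiv> labelling (odd_columns x)"
  shows "sdrdf (prism m) f" "weight (prism m) f = int m + x"
proof -
  show "sdrdf (prism m) f"
    unfolding sdrdf_prism_iff[OF assms(1)] f_def prism_columns_labelling
  proof (intro allI conjI)
    fix i
    show "odd_columns x (i mod m) \<in> set columns"
      using assms(2) by (auto simp: odd_columns_def columns_def)
    define j where "j = i mod m"
    have j: "j < m" using assms(1) by (simp add: j_def)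
    show "column_ok (odd_columns x (i mod m)) (odd_columns x (Suc i mod m))
        (odd_columns x (Suc (Suc i) mod m))"
    proof -
      have next1: "Suc i mod m = (if Suc j = m then 0 else Suc j)"
        and next2: "Suc (Suc i) mod m =
          (if Suc j = m then 1 else if Suc (Suc j) = m then 0 else Suc (Suc j))"
        using assms(1) j by (auto simp: mod_Suc j_def)
      have "j mod 4 < 4" by simp
      then consider "j mod 4 = 0" | "j mod 4 = 1" | "j mod 4 = 2" | "j mod 4 = 3"
        by linarith
      then show ?thesis
        unfolding next1 next2 j_def[symmetric]
        by cases (use assms(1,2) in \<open>auto simp: odd_columns_def column_ok_def vertex_ok_def mod_Suc\<close>)
    qed
  qed
  have "(\<Sum>i<Suc k. column_weight (odd_columns x i)) = int k + x + 1" for k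
    by (induction k) (auto simp: odd_columns_def column_weight_def)
  from this[of "m - 1"] show "weight (prism m) f = int m + x"
    using assms(1) by (simp add: weight_prism prism_columns_labelling f_def)
qed

theorem theorem6:
  fixes m :: nat
  assumes "m \<ge> 3"
  shows "(m mod 2 = 0 \<longrightarrow> gamma_sdR (prism m) = int m) \<and>
         (m mod 4 = 3 \<longrightarrow> gamma_sdR (prism m) = int m + 1) \<and>
         (m mod 4 = 1 \<longrightarrow> gamma_sdR (prism m) = int m + 2)"
proof (intro conjI impI)
  have finite: "finite (verts (prism m))"
    using simple_graph_prism[OF assms] by (simp add: simple_graph_def)
  have lower: "int m \<le> weight (prism m) f"
    and lower_odd: "odd m \<Longrightarrow> int m + 1 \<le> weight (prism m) f"
    and tight: "odd m \<Longrightarrow> weight (prism m) f = int m + 1 \<Longrightarrow> m mod 4 = 3"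
    if "sdrdf (prism m) f" for f
  proof -
    interpret column_cycle m "prism_columns m f"
      using assms that by (rule column_cycle_prism)
    show "int m \<le> weight (prism m) f"
      using weight_ge gaps_nonneg by (simp add: weight_prism)
    show "int m + 1 \<le> weight (prism m) f" if "odd m"
      using weight_ge gaps_nonneg even_if_no_gaps that by (fastforce simp: weight_prism)
    show "m mod 4 = 3" if "odd m" "weight (prism m) f = int m + 1"
      using mod_4_if_tight that by (simp add: weight_prism)
  qed
  show "gamma_sdR (prism m) = int m" if "m mod 2 = 0"
    using finite labelling_even[OF assms] lower that by (intro gamma_sdR_eqI) (auto simp: even_iff_mod_2_eq_zero)
  show "gamma_sdR (prism m) = int m + 1" if "m mod 4 = 3"
  proof -
    from that have "odd m" by presburger
    then show ?thesis
      using finite labelling_odd[OF assms, of 1] lower_odd that by (intro gamma_sdR_eqI) auto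
  qed
  show "gamma_sdR (prism m) = int m + 2" if "m mod 4 = 1"
  proof -
    from that have "odd m" by presburger
    \<comment> \<open>By \<open>tight\<close>, weight \<open>m + 1\<close> would need
      \<open>m mod 4 = 3\<close>.\<close>
    then have "int m + 2 \<le> weight (prism m) f" if "sdrdf (prism m) f" for f
      using lower_odd[OF that] tight[OF that] \<open>m mod 4 = 1\<close> by fastforce
    then show ?thesis
      using finite labelling_odd[OF assms, of 2] that by (intro gamma_sdR_eqI) auto
  qed
qed

end
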